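(* For any integer $k \geq 3$ and infinitely many values of $n$, there exist $n$-vertex graphs $G$ with \[ \operatorname{pn}_\ell(G) \leq \operatorname{pn}_u(G) \leq k+2 \quad \text{and} \quad \operatorname{pn}(G) = \Omega\left(\sqrt{k}\, n^{1/2-1/k}\right). \] In contrast, for every graph $G$ we have $\operatorname{pn}_u(G) \leq 4 \operatorname{pn}_\ell(G)+2$.
   Context: All graphs are finite and simple. A linear embedding of a graph $G=(V,E)$ is a pair $(\prec,\mathcal{P})$ where $\prec$ is a total ordering of $V$ (the spine ordering) and $\mathcal{P}$ is a partition of $E$ into parts called pages. Two edges $uv, xy$ with $u\prec v$, $x \prec y$ cross if $u \prec x \prec v \prec y$ or $x \prec u \prec y \prec v$. A book embedding is a linear embedding in which no two crossing edges lie on the same page. The page number $\operatorname{pn}(G)$ is the minimum number of pages of a book embedding of $G$. For a book embedding and a vertex $v$, let $\mathcal{P}_v$ be the set of pages containing at least one edge incident to $v$; the embedding is $k$-local if $|\mathcal{P}_v| \le k$ for all $v$, and the local page number $\operatorname{pn}_\ell(G)$ is the smallest $k$ such that $G$ has a $k$-local book embedding (with any number of pages). For a linear embedding and page $P$, let $G_P$ be the subgraph of $G$ consisting of the edges in $P$ and all vertices incident to some edge of $P$. A union embedding is a linear embedding such that for every page $P$ and every connected component $C$ of $G_P$, no two edges of $C$ cross. The union page number $\operatorname{pn}_u(G)$ is the smallest number of pages of a union embedding of $G$. The $\Omega$ refers to asymptotics as $n \to \infty$. *)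

theory Defs
  imports Complex_Main
begin

definition simple_graph :: "'a set \<Rightarrow> 'a set set \<Rightarrow> bool" where
  "simple_graph V E \<longleftrightarrow> finite V \<and> (\<forall>e\<in>E. e \<subseteq> V \<and> card e = 2)"

text \<open>A linear embedding is given by a spine ordering (an injective map of V into nat,
  vertices compared by their positions) and a page assignment of the edges; the pages
  are the nonempty classes of the assignment, so the number of pages is card (p ` E).\<close>
definition linear_embedding :: "'a set \<Rightarrow> 'a set set \<Rightarrow> ('a \<Rightarrow> nat) \<Rightarrow> ('a set \<Rightarrow> nat) \<Rightarrow> bool" where
  "linear_embedding V E \<sigma> p \<longleftrightarrow> inj_on \<sigma> V"

definition num_pages :: "'a set set \<Rightarrow> ('a set \<Rightarrow> nat) \<Rightarrow> nat" where
  "num_pages E p = card (p ` E)"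

definition cross :: "('a \<Rightarrow> nat) \<Rightarrow> 'a set \<Rightarrow> 'a set \<Rightarrow> bool" where
  "cross \<sigma> e f \<longleftrightarrow> (\<exists>u v x y. e = {u, v} \<and> f = {x, y} \<and>
      ((\<sigma> u < \<sigma> x \<and> \<sigma> x < \<sigma> v \<and> \<sigma> v < \<sigma> y) \<or>
       (\<sigma> x < \<sigma> u \<and> \<sigma> u < \<sigma> y \<and> \<sigma> y < \<sigma> v)))"

definition book_embedding :: "'a set \<Rightarrow> 'a set set \<Rightarrow> ('a \<Rightarrow> nat) \<Rightarrow> ('a set \<Rightarrow> nat) \<Rightarrow> bool" where
  "book_embedding V E \<sigma> p \<longleftrightarrow> linear_embedding V E \<sigma> p \<and>
     (\<forall>e\<in>E. \<forall>f\<in>E. p e = p f \<longrightarrow> \<not> cross \<sigma> e f)"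

definition page_number :: "'a set \<Rightarrow> 'a set set \<Rightarrow> nat" where
  "page_number V E = (LEAST k. \<exists>\<sigma> p. book_embedding V E \<sigma> p \<and> num_pages E p = k)"

definition pages_at :: "'a set set \<Rightarrow> ('a set \<Rightarrow> nat) \<Rightarrow> 'a \<Rightarrow> nat set" where
  "pages_at E p v = {p e | e. e \<in> E \<and> v \<in> e}"

definition local_embedding :: "nat \<Rightarrow> 'a set \<Rightarrow> 'a set set \<Rightarrow> ('a \<Rightarrow> nat) \<Rightarrow> ('a set \<Rightarrow> nat) \<Rightarrow> bool" where
  "local_embedding k V E \<sigma> p \<longleftrightarrow> book_embedding V E \<sigma> p \<and> (\<forall>v\<in>V. card (pages_at E p v) \<le> k)"

definition local_page_number :: "'a set \<Rightarrow> 'a set set \<Rightarrow> nat" where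
  "local_page_number V E = (LEAST k. \<exists>\<sigma> p. local_embedding k V E \<sigma> p)"

text \<open>Two edges of page i are adjacent in G_P if they share a vertex; two edges lie in the
  same connected component of G_P iff they are related by the reflexive-transitive closure.\<close>
definition page_adj :: "'a set set \<Rightarrow> ('a set \<Rightarrow> nat) \<Rightarrow> nat \<Rightarrow> ('a set \<times> 'a set) set" where
  "page_adj E p i = {(e, f). e \<in> E \<and> f \<in> E \<and> p e = i \<and> p f = i \<and> e \<inter> f \<noteq> {}}"

definition union_embedding :: "'a set \<Rightarrow> 'a set set \<Rightarrow> ('a \<Rightarrow> nat) \<Rightarrow> ('a set \<Rightarrow> nat) \<Rightarrow> bool" where
  "union_embedding V E \<sigma> p \<longleftrightarrow> linear_embedding V E \<sigma> p \<and>
     (\<forall>e\<in>E. \<forall>f\<in>E. p e = p f \<and> (e, f) \<in> (page_adj E p (p e))\<^sup>* \<longrightarrow> \<not> cross \<sigma> e f)"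

definition union_page_number :: "'a set \<Rightarrow> 'a set set \<Rightarrow> nat" where
  "union_page_number V E = (LEAST k. \<exists>\<sigma> p. union_embedding V E \<sigma> p \<and> num_pages E p = k)"

end

theory Submission
  imports Defs "HOL-Library.FuncSet" "HOL-Library.Infinite_Set"
begin

text \<open>
  A star forest is a page of a union embedding for every spine ordering, so both upper bounds on
  the union page number come from decompositions into star forests.

  For the first part, take \<open>k\<close> random maps from one half of the \<open>n\<close> vertices to the other half and
  the graph formed by all their arrows; each map yields a star forest. If the graph has a book
  embedding with \<open>t\<close> pages, cut the spine into \<open>s\<close> blocks of equal size. Contracting the blocks turns
  every page into one of at most \<open>64 ^ s\<close> non-crossing graphs, each with at most \<open>2 * s\<close> edges. So
  all arrows lie between at most \<open>5 * s * t\<close> of the \<open>s\<^sup>2\<close> ordered pairs of blocks. For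
  \<open>s\<close> of order \<open>t * n powr (2 / k)\<close> and \<open>s * t \<le> k * n / 2\<close> this is so unlikely that a union bound over
  all spine orderings and all contracted pages still leaves a graph with more than \<open>t\<close> pages.

  For the second part, every edge of a crossing-free page is the longest edge to the right at its
  left end or the longest edge to the left at its right end. Numbering the pages at each vertex by
  \<open>1, \<dots>, k\<close> therefore splits a \<open>k\<close>-local book embedding into \<open>2 * k\<close> forests, in which every
  vertex has at most one parent, always in the same direction along the spine. Splitting each forest
  by the parity of the depth gives \<open>4 * k\<close> star forests.
\<close>

section \<open>Embeddings and page numbers\<close>

lemma simple_graph_finite_edges:
  assumes "simple_graph V E"
  shows "finite E"
  using assms unfolding simple_graph_def by (meson PowI finite_Pow_iff finite_subset subsetI)

lemma cross_disjoint: "cross \<sigma> e f \<Longrightarrow> e \<inter> f = {}"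
  unfolding cross_def by auto

lemma exists_inj_to_nat:
  assumes "finite A"
  shows "\<exists>f::'a \<Rightarrow> nat. inj_on f A"
  using finite_imp_inj_to_nat_seg[OF assms] by blast

text \<open>Giving every edge its own page works, since no edge crosses itself. This makes the sets
  behind all three \<open>LEAST\<close> operators nonempty.\<close>

lemma exists_book_embedding:
  assumes "simple_graph V E"
  shows "\<exists>\<sigma> p. book_embedding V E \<sigma> p"
proof -
  obtain \<sigma> :: "'a \<Rightarrow> nat" where \<sigma>: "inj_on \<sigma> V"
    using assms exists_inj_to_nat unfolding simple_graph_def by blast
  obtain p :: "'a set \<Rightarrow> nat" where p: "inj_on p E"
    using exists_inj_to_nat[OF simple_graph_finite_edges[OF assms]] by blast
  have "e \<inter> e \<noteq> {}" if "e \<in> E" for e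
    using assms that unfolding simple_graph_def by force
  then have "\<forall>e\<in>E. \<forall>f\<in>E. p e = p f \<longrightarrow> \<not> cross \<sigma> e f"
    using p cross_disjoint by (metis inj_onD)
  then show ?thesis
    using \<sigma> unfolding book_embedding_def linear_embedding_def by blast
qed

lemma page_number_attained:
  assumes "simple_graph V E"
  obtains \<sigma> p where "book_embedding V E \<sigma> p" "num_pages E p = page_number V E"
proof -
  obtain \<sigma> p where "book_embedding V E \<sigma> p"
    using exists_book_embedding[OF assms] by blast
  then have "\<exists>k \<sigma> p. book_embedding V E \<sigma> p \<and> num_pages E p = k" by blast
  from LeastI_ex[OF this] show ?thesis
    using that unfolding page_number_def by blast
qed

lemma local_page_number_attained:
  assumes "simple_graph V E"
  obtains \<sigma> p where "local_embedding (local_page_number V E) V E \<sigma> p"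
proof -
  obtain \<sigma> p where b: "book_embedding V E \<sigma> p"
    using exists_book_embedding[OF assms] by blast
  have "pages_at E p v \<subseteq> p ` E" for v
    unfolding pages_at_def by blast
  then have "card (pages_at E p v) \<le> card (p ` E)" for v
    using simple_graph_finite_edges[OF assms] by (simp add: card_mono)
  with b have "local_embedding (card (p ` E)) V E \<sigma> p"
    unfolding local_embedding_def by blast
  then have "\<exists>k \<sigma> p. local_embedding k V E \<sigma> p" by blast
  from LeastI_ex[OF this] show ?thesis
    using that unfolding local_page_number_def by blast
qed

lemma union_page_number_attained:
  assumes "simple_graph V E"
  obtains \<sigma> p where "union_embedding V E \<sigma> p" "num_pages E p = union_page_number V E"
proof -
  obtain \<sigma> p where "book_embedding V E \<sigma> p"
    using exists_book_embedding[OF assms] by blast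
  then have "union_embedding V E \<sigma> p"
    unfolding book_embedding_def union_embedding_def by blast
  then have "\<exists>k \<sigma> p. union_embedding V E \<sigma> p \<and> num_pages E p = k" by blast
  from LeastI_ex[OF this] show ?thesis
    using that unfolding union_page_number_def by blast
qed

text \<open>Turn each component of each page of a union embedding into a page of its own. Edges of
  one page that meet at \<open>v\<close> lie in one component, so \<open>v\<close> sees at most one
  new page per old page.\<close>

lemma local_page_number_le_union_page_number:
  assumes G: "simple_graph V E"
  shows "local_page_number V E \<le> union_page_number V E"
proof -
  obtain \<sigma> p where u: "union_embedding V E \<sigma> p" and n: "num_pages E p = union_page_number V E"
    using union_page_number_attained[OF G] .
  have fin: "finite E" using simple_graph_finite_edges[OF G] .
  define C where "C e = (page_adj E p (p e))\<^sup>* `` {e}" for e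
  define q where "q e = (p e, C e)" for e
  obtain h :: "nat \<times> 'a set set \<Rightarrow> nat" where h: "inj_on h (q ` E)"
    using exists_inj_to_nat fin by blast
  have book: "book_embedding V E \<sigma> (h \<circ> q)"
    unfolding book_embedding_def
  proof (intro conjI ballI impI)
    show "linear_embedding V E \<sigma> (h \<circ> q)"
      using u unfolding union_embedding_def linear_embedding_def by blast
    fix e f assume e: "e \<in> E" and f: "f \<in> E" and "(h \<circ> q) e = (h \<circ> q) f"
    then have "q e = q f" using h by (simp add: inj_on_def)
    then have pef: "p e = p f" and "C e = C f" by (simp_all add: q_def)
    then have "f \<in> C e" unfolding C_def by auto
    then show "\<not> cross \<sigma> e f"
      using u e f pef unfolding union_embedding_def C_def by blast
  qed
  have "card (pages_at E (h \<circ> q) v) \<le> num_pages E p" for v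
  proof -
    have same: "q e = q f" if "e \<in> E" "f \<in> E" "v \<in> e" "v \<in> f" "p e = p f" for e f
    proof -
      have "(e, f) \<in> (page_adj E p (p e))\<^sup>*" "(f, e) \<in> (page_adj E p (p e))\<^sup>*"
        using that by (auto intro!: r_into_rtrancl simp: page_adj_def)
      then have "C e = C f" unfolding C_def using that(5) by (auto intro: rtrancl_trans)
      then show ?thesis using that(5) by (simp add: q_def)
    qed
    define Ev where "Ev = {e \<in> E. v \<in> e}"
    have finv: "finite Ev" using fin by (simp add: Ev_def)
    have "fst ` q ` Ev = p ` Ev" by (force simp: q_def)
    moreover have "inj_on fst (q ` Ev)"
    proof (rule inj_onI)
      fix x y assume "x \<in> q ` Ev" "y \<in> q ` Ev" and xy: "fst x = fst y"
      then obtain e f where ef: "e \<in> Ev" "f \<in> Ev" "x = q e" "y = q f" by auto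
      then have "p e = p f" using xy by (simp add: q_def)
      then show "x = y" using same ef by (simp add: Ev_def)
    qed
    ultimately have "card (q ` Ev) = card (p ` Ev)"
      by (metis card_image)
    moreover have "pages_at E (h \<circ> q) v = h ` q ` Ev"
      unfolding pages_at_def Ev_def by auto
    ultimately have "card (pages_at E (h \<circ> q) v) \<le> card (p ` Ev)"
      using card_image_le[of "q ` Ev" h] finv by simp
    also have "\<dots> \<le> card (p ` E)"
      using fin by (intro card_mono image_mono) (auto simp: Ev_def)
    finally show ?thesis unfolding num_pages_def .
  qed
  then have "local_embedding (num_pages E p) V E \<sigma> (h \<circ> q)"
    using book unfolding local_embedding_def by blast
  then have "local_page_number V E \<le> num_pages E p"
    unfolding local_page_number_def by (intro Least_le) blast
  then show ?thesis using n by simp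
qed

text \<open>The function \<open>c\<close> selects the centre of each edge's star.\<close>
lemma union_page_number_le_star_forests:
  fixes q :: "'a set \<Rightarrow> 'b"
  assumes G: "simple_graph V E" and D: "finite D" "q ` E \<subseteq> D"
    and c: "\<And>e. e \<in> E \<Longrightarrow> c e \<in> e"
    and star: "\<And>e f. e \<in> E \<Longrightarrow> f \<in> E \<Longrightarrow> q e = q f \<Longrightarrow> e \<inter> f \<noteq> {} \<Longrightarrow> c e = c f"
  shows "union_page_number V E \<le> card D"
proof -
  obtain \<sigma> :: "'a \<Rightarrow> nat" where \<sigma>: "inj_on \<sigma> V"
    using G exists_inj_to_nat unfolding simple_graph_def by blast
  obtain h :: "'b \<Rightarrow> nat" where h: "inj_on h D"
    using exists_inj_to_nat D(1) by blast
  have comp: "c e = c f" if "(e, f) \<in> (page_adj E (h \<circ> q) i)\<^sup>*" for e f i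
    using that
  proof (induction rule: rtrancl_induct)
    case (step f g)
    then have "f \<in> E" "g \<in> E" "h (q f) = h (q g)" "f \<inter> g \<noteq> {}"
      by (auto simp: page_adj_def)
    moreover from this have "q f = q g"
      using h D(2) by (meson image_subset_iff inj_onD)
    ultimately show ?case using step.IH star by metis
  qed simp
  have "union_embedding V E \<sigma> (h \<circ> q)"
    unfolding union_embedding_def linear_embedding_def
  proof (intro conjI ballI impI \<sigma>)
    fix e f assume e: "e \<in> E" and f: "f \<in> E"
      and "(h \<circ> q) e = (h \<circ> q) f \<and> (e, f) \<in> (page_adj E (h \<circ> q) ((h \<circ> q) e))\<^sup>*"
    then have "c e = c f" using comp by blast
    then have "e \<inter> f \<noteq> {}" using c[OF e] c[OF f] by auto
    then show "\<not> cross \<sigma> e f" using cross_disjoint by metis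
  qed
  then have "union_page_number V E \<le> num_pages E (h \<circ> q)"
    unfolding union_page_number_def by (intro Least_le) blast
  also have "\<dots> \<le> card (h ` D)"
    unfolding num_pages_def using D by (intro card_mono) auto
  also have "\<dots> \<le> card D" using D(1) by (rule card_image_le)
  finally show ?thesis .
qed

section \<open>Union page number and local page number\<close>

text \<open>Read \<open>h e\<close> as the parent of \<open>t e\<close>: parents are unique and
  \<open>m\<close> decreases towards them, so the edges form a forest. When edges are added by
  increasing \<open>m (t e)\<close>, the child of the new edge lies on no earlier edge, so its
  colour is free.\<close>

lemma acyclic_parent_map_two_colouring:
  fixes m :: "'a \<Rightarrow> nat"
  assumes "finite Q" "inj_on t Q" "\<And>e. e \<in> Q \<Longrightarrow> m (h e) < m (t e)"
  shows "\<exists>col::'a \<Rightarrow> bool. \<forall>e\<in>Q. col (t e) \<noteq> col (h e)"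
  using assms
proof (induction rule: finite_ranking_induct[where f = "\<lambda>e. m (t e)"])
  case (insert x S)
  show ?case
  proof (cases "x \<in> S")
    case True
    then show ?thesis using insert by (simp add: insert_absorb)
  next
    case False
    have "\<exists>col::'a \<Rightarrow> bool. \<forall>e\<in>S. col (t e) \<noteq> col (h e)"
      using insert.prems by (intro insert.IH) auto
    then obtain col :: "'a \<Rightarrow> bool" where col: "\<And>e. e \<in> S \<Longrightarrow> col (t e) \<noteq> col (h e)" by blast
    have "t e \<noteq> t x" "h e \<noteq> t x" if "e \<in> S" for e
      using that insert.prems False insert.hyps(2)[OF that]
      by (auto simp: inj_on_def) (metis leD)
    moreover have "h x \<noteq> t x" using insert.prems(2)[of x] by auto
    ultimately show ?thesis
      using col by (intro exI[of _ "col(t x := \<not> col (h x))"]) auto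
  qed
qed simp

text \<open>The factor 4 is two directions times two depth parities. The page enters a class only
  through its number at the tail, so a class can mix edges of several pages; it is still a forest,
  because class and tail determine the edge.\<close>

lemma union_page_number_le_4_local_page_number:
  assumes G: "simple_graph V E"
  shows "union_page_number V E \<le> 4 * local_page_number V E"
proof -
  define k where "k = local_page_number V E"
  obtain \<sigma> p where le: "local_embedding k V E \<sigma> p"
    using local_page_number_attained[OF G] unfolding k_def by blast
  have \<sigma>: "inj_on \<sigma> V"
    and nocross: "\<And>e f. e \<in> E \<Longrightarrow> f \<in> E \<Longrightarrow> p e = p f \<Longrightarrow> \<not> cross \<sigma> e f"
    and loc: "\<And>v. v \<in> V \<Longrightarrow> card (pages_at E p v) \<le> k"
    using le unfolding local_embedding_def book_embedding_def linear_embedding_def by auto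
  have fin: "finite E" using simple_graph_finite_edges[OF G] .
  have "\<exists>u v. e = {u, v} \<and> \<sigma> u < \<sigma> v \<and> u \<in> V \<and> v \<in> V" if "e \<in> E" for e
  proof -
    from that G have "e \<subseteq> V" "card e = 2" unfolding simple_graph_def by auto
    then obtain u v where uv: "e = {u, v}" "u \<noteq> v" "u \<in> V" "v \<in> V"
      by (auto simp: card_2_iff)
    then have "\<sigma> u \<noteq> \<sigma> v" using \<sigma> by (auto dest: inj_onD)
    then show ?thesis using uv by (metis insert_commute nat_neq_iff)
  qed
  then obtain lo hi where lohi: "\<And>e. e \<in> E \<Longrightarrow> e = {lo e, hi e}"
    "\<And>e. e \<in> E \<Longrightarrow> \<sigma> (lo e) < \<sigma> (hi e)"
    "\<And>e. e \<in> E \<Longrightarrow> lo e \<in> V" "\<And>e. e \<in> E \<Longrightarrow> hi e \<in> V"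
    by metis
  define right where
    "right e \<longleftrightarrow> (\<forall>f\<in>E. p f = p e \<longrightarrow> lo f = lo e \<longrightarrow> \<sigma> (hi f) \<le> \<sigma> (hi e))" for e
  define left where
    "left e \<longleftrightarrow> (\<forall>f\<in>E. p f = p e \<longrightarrow> hi f = hi e \<longrightarrow> \<sigma> (lo e) \<le> \<sigma> (lo f))" for e
  \<comment> \<open>If both fail, some \<open>f\<close> on the page leaves the left end of
    \<open>e\<close> and reaches further right, and some \<open>g\<close> leaves its right end and
    reaches further left; then \<open>g\<close> and \<open>f\<close> cross.\<close>
  have right_or_left: "right e \<or> left e" if e: "e \<in> E" for e
  proof (rule ccontr)
    assume "\<not> (right e \<or> left e)"
    then obtain f g where f: "f \<in> E" "p f = p e" "lo f = lo e" "\<sigma> (hi e) < \<sigma> (hi f)"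
      and g: "g \<in> E" "p g = p e" "hi g = hi e" "\<sigma> (lo g) < \<sigma> (lo e)"
      unfolding right_def left_def by (auto simp: not_le)
    have "cross \<sigma> g f"
      unfolding cross_def
      by (rule exI[of _ "lo g"], rule exI[of _ "hi g"], rule exI[of _ "lo f"], rule exI[of _ "hi f"])
        (use f g lohi(1)[OF f(1)] lohi(1)[OF g(1)] lohi(2)[OF e] in simp)
    then show False using nocross f g by metis
  qed
  \<comment> \<open>Each edge is oriented so that on its page it is the longest one leaving its tail
    in its direction; \<open>right\<close> wins if both hold.\<close>
  define tail where "tail e = (if right e then lo e else hi e)" for e
  define head where "head e = (if right e then hi e else lo e)" for e
  have ends: "e = {tail e, head e}" "tail e \<in> V" if "e \<in> E" for e
    using lohi[OF that] by (auto simp: tail_def head_def)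
  have mem_edge: "x \<in> e \<longleftrightarrow> x = tail e \<or> x = head e" if "e \<in> E" for x e
    using eqset_imp_iff[OF ends(1)[OF that], of x] by simp
  have tail_unique: "e = f"
    if "e \<in> E" "f \<in> E" "p e = p f" "right e = right f" "tail e = tail f" for e f
  proof (cases "right e")
    case True
    then have "lo e = lo f" "\<sigma> (hi e) \<le> \<sigma> (hi f)" "\<sigma> (hi f) \<le> \<sigma> (hi e)"
      using that by (auto simp: tail_def right_def)
    then show ?thesis using \<sigma> lohi that(1,2) by (metis inj_onD le_antisym)
  next
    case False
    then have "left e" "left f" using that right_or_left by auto
    moreover have "hi e = hi f" using False that by (auto simp: tail_def)
    ultimately have "\<sigma> (lo e) \<le> \<sigma> (lo f)" "\<sigma> (lo f) \<le> \<sigma> (lo e)"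
      using that by (auto simp: left_def)
    then show ?thesis using \<sigma> lohi that(1,2) \<open>hi e = hi f\<close> by (metis inj_onD le_antisym)
  qed
  \<comment> \<open>The numbering is local: a page may get different numbers at different vertices,
    so \<open>k\<close> numbers suffice whatever the total number of pages.\<close>
  have "\<exists>g. inj_on g (pages_at E p v) \<and> g ` pages_at E p v \<subseteq> {..<k}" if "v \<in> V" for v
  proof -
    have "finite (pages_at E p v)" using fin unfolding pages_at_def by simp
    then show ?thesis
      using card_le_inj[of "pages_at E p v" "{..<k}"] loc[OF that] by auto
  qed
  then obtain lab where lab: "\<And>v. v \<in> V \<Longrightarrow> inj_on (lab v) (pages_at E p v)"
    "\<And>v. v \<in> V \<Longrightarrow> lab v ` pages_at E p v \<subseteq> {..<k}" by metis
  have page_mem: "p e \<in> pages_at E p (tail e)" if "e \<in> E" for e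
    using that mem_edge[OF that] unfolding pages_at_def by blast
  define cl where "cl e = (right e, lab (tail e) (p e))" for e
  have cl_tail: "e = f" if "e \<in> E" "f \<in> E" "cl e = cl f" "tail e = tail f" for e f
  proof -
    have "lab (tail e) (p e) = lab (tail e) (p f)" using that by (simp add: cl_def)
    then have "p e = p f"
      using lab(1) ends(2) page_mem that by (metis inj_onD)
    then show ?thesis using tail_unique that by (simp add: cl_def)
  qed
  have "\<exists>col::'a \<Rightarrow> bool. \<forall>e\<in>{e \<in> E. cl e = x}. col (tail e) \<noteq> col (head e)" for x
  proof -
    obtain B where B: "\<And>v. v \<in> V \<Longrightarrow> \<sigma> v \<le> B"
      using G unfolding simple_graph_def
      by (metis finite_imageI finite_nat_set_iff_bounded_le imageI)
    \<comment> \<open>All edges of a class point the same way, so the spine position, reversed for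
      rightward edges, drops from tail to head. The bound \<open>B\<close> keeps the subtraction
      from truncating.\<close>
    define m where "m v = (if fst x then B - \<sigma> v else \<sigma> v)" for v
    show ?thesis
    proof (rule acyclic_parent_map_two_colouring[where m = m])
      fix e assume "e \<in> {e \<in> E. cl e = x}"
      then show "m (head e) < m (tail e)"
        using lohi[of e] B[of "hi e"] by (auto simp: m_def cl_def head_def tail_def)
    next
      show "inj_on tail {e \<in> E. cl e = x}" using cl_tail by (auto simp: inj_on_def)
    qed (use fin in simp)
  qed
  then obtain col :: "bool \<times> nat \<Rightarrow> 'a \<Rightarrow> bool" where
    col: "\<And>e. e \<in> E \<Longrightarrow> col (cl e) (tail e) \<noteq> col (cl e) (head e)" by simp metis
  define q where "q e = (cl e, col (cl e) (tail e))" for e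
  have "union_page_number V E \<le> card (((UNIV::bool set) \<times> {..<k}) \<times> (UNIV::bool set))"
  proof (rule union_page_number_le_star_forests[OF G, where q = q and c = head])
    show "q ` E \<subseteq> (UNIV \<times> {..<k}) \<times> UNIV"
      using lab(2)[OF ends(2)] page_mem by (auto simp: q_def cl_def image_subset_iff)
    show "head e \<in> e" if "e \<in> E" for e using mem_edge[OF that] by simp
    \<comment> \<open>Within a class of \<open>q\<close> tails have one colour and heads the other,
      so meeting edges share a tail, and are then equal, or share a head.\<close>
    show "head e = head f"
      if e: "e \<in> E" and f: "f \<in> E" and q: "q e = q f" and "e \<inter> f \<noteq> {}" for e f
    proof -
      have "tail e = tail f \<or> tail e = head f \<or> head e = tail f \<or> head e = head f"
        using that(4) mem_edge[OF e] mem_edge[OF f] by (metis disjoint_iff)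
      moreover have "cl e = cl f" "col (cl e) (tail e) = col (cl e) (tail f)"
        using q by (auto simp: q_def)
      ultimately show ?thesis using col[OF e] col[OF f] cl_tail[OF e f] by metis
    qed
  qed simp
  also have "\<dots> = 4 * k" by (simp add: card_cartesian_product)
  finally show ?thesis by (simp add: k_def)
qed

section \<open>Counting non-crossing graphs on an ordered vertex set\<close>

text \<open>The vertices stand for blocks of the spine, and each edge is recorded once, as an
  increasing pair; edges inside a block leave no trace. Quantifying over ordered pairs of edges
  covers both crossing patterns.\<close>

definition noncrossing :: "nat \<Rightarrow> (nat \<times> nat) set set" where
  "noncrossing s = {A. A \<subseteq> {..<s} \<times> {..<s} \<and> (\<forall>(i, j)\<in>A. i < j) \<and>
     (\<forall>(i, j)\<in>A. \<forall>(i', j')\<in>A. \<not> (i < i' \<and> i' < j \<and> j < j'))}"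

lemma noncrossingD:
  assumes "A \<in> noncrossing s"
  shows "finite A" "(i, j) \<in> A \<Longrightarrow> i < j" "(i, j) \<in> A \<Longrightarrow> i < s \<and> j < s"
    "(i, j) \<in> A \<Longrightarrow> (i', j') \<in> A \<Longrightarrow> i < i' \<Longrightarrow> i' < j \<Longrightarrow> j' \<le> j"
proof -
  show "finite A" using assms finite_subset[of A "{..<s} \<times> {..<s}"] unfolding noncrossing_def by auto
  show "(i, j) \<in> A \<Longrightarrow> i < j" "(i, j) \<in> A \<Longrightarrow> i < s \<and> j < s"
    using assms unfolding noncrossing_def by auto
  show "(i, j) \<in> A \<Longrightarrow> (i', j') \<in> A \<Longrightarrow> i < i' \<Longrightarrow> i' < j \<Longrightarrow> j' \<le> j"
    using assms unfolding noncrossing_def by (fastforce simp: not_less)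
qed

text \<open>An edge that is neither the longest to the right at its left end nor the longest to the
  left at its right end would lie under two crossing edges. \<open>?R\<close> and \<open>?L\<close>
  hold one candidate of each kind per vertex.\<close>

lemma card_noncrossing_edges:
  assumes A: "A \<in> noncrossing s"
  shows "card A \<le> 2 * s"
proof -
  let ?R = "(\<lambda>i. (i, Max (A `` {i}))) ` {..<s}" and ?L = "(\<lambda>j. (Min (A\<inverse> `` {j}), j)) ` {..<s}"
  have fin: "finite (A `` {i})" "finite (A\<inverse> `` {i})" for i
    using noncrossingD(1)[OF A] by (simp_all add: finite_Image)
  have "A \<subseteq> ?R \<union> ?L"
  proof (rule ccontr)
    assume "\<not> A \<subseteq> ?R \<union> ?L"
    then obtain i j where ij: "(i, j) \<in> A" and "(i, j) \<notin> ?R" "(i, j) \<notin> ?L" by auto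
    then have ne: "j \<noteq> Max (A `` {i})" "i \<noteq> Min (A\<inverse> `` {j})"
      using noncrossingD(3)[OF A ij] by auto
    have "j \<le> Max (A `` {i})" "Min (A\<inverse> `` {j}) \<le> i"
      using ij fin by auto
    moreover have "Max (A `` {i}) \<in> A `` {i}" "Min (A\<inverse> `` {j}) \<in> A\<inverse> `` {j}"
      using ij fin Max_in Min_in by blast+
    ultimately obtain i' j' where "(i, j') \<in> A" "(i', j) \<in> A" "j < j'" "i' < i"
      using ne by (metis Image_singleton_iff converse_iff le_neq_implies_less)
    then show False
      using noncrossingD(4)[OF A, of i' j i j'] noncrossingD(2)[OF A ij] by simp
  qed
  then have "card A \<le> card (?R \<union> ?L)" by (intro card_mono) auto
  also have "\<dots> \<le> card ?R + card ?L" by (rule card_Un_le)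
  also have "\<dots> \<le> s + s"
    by (intro add_mono) (metis card_image_le card_lessThan finite_lessThan)+
  finally show ?thesis by simp
qed

text \<open>Read from left to right, each vertex closes the most recently opened edges, so the degree
  sequences determine the graph as in a matching of parentheses.\<close>
lemma noncrossing_eqI_degrees:
  assumes A: "A \<in> noncrossing s" and B: "B \<in> noncrossing s"
    and out: "\<And>i. card (A `` {i}) = card (B `` {i})"
    and inc: "\<And>j. card (A\<inverse> `` {j}) = card (B\<inverse> `` {j})"
  shows "A = B"
proof -
  \<comment> \<open>\<open>C\<close> and \<open>D\<close> agree on edges ending before
    \<open>j\<close>, and \<open>i'\<close> has equally many right neighbours in both. As
    \<open>D\<close> joins \<open>i'\<close> to \<open>j\<close>, some edge of \<open>C\<close>
    joins \<open>i'\<close> to a \<open>j'' >= j\<close>; not crossing \<open>(i, j)\<close> forces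
    \<open>j'' = j\<close>.\<close>
  have open_up: "i' \<in> C\<inverse> `` {j}"
    if C: "C \<in> noncrossing s" and D: "D \<in> noncrossing s"
      and deg: "card (C `` {i'}) = card (D `` {i'})"
      and eq: "\<And>i j'. j' < j \<Longrightarrow> (i, j') \<in> C \<longleftrightarrow> (i, j') \<in> D"
      and i: "i \<in> C\<inverse> `` {j}" and i': "i' \<in> D\<inverse> `` {j}" and "i < i'" for C D i i' j
  proof -
    have split: "card (X `` {i'}) = card (X `` {i'} \<inter> {..<j}) + card (X `` {i'} \<inter> {j..})"
      if "X \<in> noncrossing s" for X
    proof -
      have "finite (X `` {i'})" using noncrossingD(1)[OF that] by (simp add: finite_Image)
      then have "card ((X `` {i'} \<inter> {..<j}) \<union> (X `` {i'} \<inter> {j..}))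
          = card (X `` {i'} \<inter> {..<j}) + card (X `` {i'} \<inter> {j..})"
        by (intro card_Un_disjoint) auto
      moreover have "(X `` {i'} \<inter> {..<j}) \<union> (X `` {i'} \<inter> {j..}) = X `` {i'}" by auto
      ultimately show ?thesis by simp
    qed
    have "C `` {i'} \<inter> {..<j} = D `` {i'} \<inter> {..<j}" using eq by auto
    then have "card (C `` {i'} \<inter> {j..}) = card (D `` {i'} \<inter> {j..})"
      using split[OF C] split[OF D] deg by simp
    moreover have "finite (D `` {i'} \<inter> {j..})"
      using noncrossingD(1)[OF D] by (simp add: finite_Image)
    moreover have "j \<in> D `` {i'} \<inter> {j..}" using i' by auto
    ultimately have "C `` {i'} \<inter> {j..} \<noteq> {}" by (metis card_0_eq card.empty empty_iff)
    then obtain j'' where j'': "(i', j'') \<in> C" "j \<le> j''" by auto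
    have "i' < j" using i' noncrossingD(2)[OF D] by auto
    then have "j'' \<le> j" using noncrossingD(4)[OF C _ j''(1)] i \<open>i < i'\<close> by auto
    then show ?thesis using j'' by auto
  qed
  have "A\<inverse> `` {j} = B\<inverse> `` {j}" for j
  proof (induction j rule: less_induct)
    case (less j)
    then have eq: "(i, j') \<in> A \<longleftrightarrow> (i, j') \<in> B" if "j' < j" for i j'
      using that by blast
    have fin: "finite (A\<inverse> `` {j})" "finite (B\<inverse> `` {j})"
      using noncrossingD(1) A B by (simp_all add: finite_Image)
    show ?case
    proof (rule ccontr)
      assume "A\<inverse> `` {j} \<noteq> B\<inverse> `` {j}"
      \<comment> \<open>Distinct finite sets of equal size each have an element that the other
        lacks; \<open>open_up\<close> refutes the larger of these two elements.\<close>
      then have "\<not> A\<inverse> `` {j} \<subseteq> B\<inverse> `` {j}" "\<not> B\<inverse> `` {j} \<subseteq> A\<inverse> `` {j}"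
        using inc[of j] fin by (metis card_subset_eq)+
      then obtain i i' where i: "i \<in> A\<inverse> `` {j}" "i \<notin> B\<inverse> `` {j}"
        and i': "i' \<in> B\<inverse> `` {j}" "i' \<notin> A\<inverse> `` {j}" by blast
      then consider "i < i'" | "i' < i" by (metis nat_neq_iff)
      then show False
      proof cases
        case 1
        then show False using open_up[OF A B out _ i(1) i'(1)] eq i' by blast
      next
        case 2
        then show False using open_up[OF B A out[symmetric] _ i'(1) i(1)] eq i by blast
      qed
    qed
  qed
  then show ?thesis by (metis Image_singleton_iff converse_iff subrelI subset_antisym)
qed

lemma sum_card_Image:
  fixes A :: "(nat \<times> 'b) set"
  assumes "finite A" "A \<subseteq> {..<s} \<times> UNIV"
  shows "(\<Sum>i<s. card (A `` {i})) = card A"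
proof -
  have "A = (SIGMA i:{..<s}. A `` {i})" using assms(2) by auto
  then have "card A = card (SIGMA i:{..<s}. A `` {i})" by simp
  also have "\<dots> = (\<Sum>i<s. card (A `` {i}))"
    using assms(1) by (intro card_SigmaI) (auto intro: finite_Image)
  finally show ?thesis by simp
qed

lemma finite_noncrossing: "finite (noncrossing s)"
  by (rule finite_subset[of _ "Pow ({..<s} \<times> {..<s})"]) (auto simp: noncrossing_def)

text \<open>The degrees, with one padding entry, form a list of length \<open>2 * s + 1\<close> and
  sum \<open>4 * s\<close>; stars and bars counts these lists. At most \<open>2 * s\<close> edges
  means that the padding does not truncate.\<close>

lemma card_noncrossing: "card (noncrossing s) \<le> 64 ^ s"
proof -
  \<comment> \<open>The last entry pads the total to the same value for all graphs.\<close>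
  define code where "code A = map (\<lambda>i. card (A `` {i})) [0..<s] @ map (\<lambda>j. card (A\<inverse> `` {j})) [0..<s]
    @ [4 * s - 2 * card A]" for A :: "(nat \<times> nat) set"
  let ?L = "{l::nat list. length l = 2 * s + 1 \<and> sum_list l = 4 * s}"
  have cardL: "card ?L = 6 * s choose (4 * s)"
    using card_length_sum_list[of "2 * s + 1" "4 * s"] by simp
  have "inj_on code (noncrossing s)"
  proof (rule inj_onI)
    fix A B assume A: "A \<in> noncrossing s" and B: "B \<in> noncrossing s" and "code A = code B"
    then have "card (A `` {i}) = card (B `` {i})" "card (A\<inverse> `` {i}) = card (B\<inverse> `` {i})"
      if "i < s" for i
      using that by (auto simp: code_def)
    moreover have "X `` {i} = {}" "X\<inverse> `` {i} = {}" if "X \<in> noncrossing s" "\<not> i < s" for X i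
      using noncrossingD(3)[OF that(1)] that(2) by auto
    ultimately have "card (A `` {i}) = card (B `` {i})" "card (A\<inverse> `` {i}) = card (B\<inverse> `` {i})" for i
      using A B by (cases "i < s"; simp)+
    then show "A = B" using noncrossing_eqI_degrees[OF A B] by blast
  qed
  moreover have "code ` noncrossing s \<subseteq> ?L"
  proof clarify
    fix A assume A: "A \<in> noncrossing s"
    have "(\<Sum>i<s. card (A `` {i})) = card A"
      using noncrossingD[OF A] by (intro sum_card_Image) auto
    moreover have "(\<Sum>i<s. card (A\<inverse> `` {i})) = card (A\<inverse>)"
      using noncrossingD[OF A] by (intro sum_card_Image) auto
    ultimately show "length (code A) = 2 * s + 1 \<and> sum_list (code A) = 4 * s"
      using card_noncrossing_edges[OF A]
      by (simp add: code_def interv_sum_list_conv_sum_set_nat atLeast0LessThan)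
  qed
  moreover have "finite ?L"
  proof (cases "s = 0")
    case False
    then show ?thesis using cardL by (intro card_ge_0_finite) simp
  qed (auto intro: finite_subset[of _ "{[0]}"] simp: length_Suc_conv)
  ultimately have "card (noncrossing s) \<le> card ?L" by (rule card_inj_on_le)
  also have "\<dots> = 6 * s choose (4 * s)" by (rule cardL)
  also have "\<dots> \<le> 2 ^ (6 * s)" by (rule binomial_le_pow2)
  also have "\<dots> = 64 ^ s" by (simp add: power_mult)
  finally show ?thesis .
qed

section \<open>Unions of random star forests have large page number\<close>

text \<open>Map \<open>j\<close> sends \<open>i\<close> to \<open>F (j, i)\<close>, shifted by
  \<open>N\<close> into the second half. Packing all maps into one function makes them easy to
  count; coinciding arrows merge into one edge.\<close>

definition star_edges :: "nat \<Rightarrow> nat \<Rightarrow> (nat \<times> nat \<Rightarrow> nat) \<Rightarrow> nat set set" where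
  "star_edges N k F = {{i, N + F (j, i)} | i j. i < N \<and> j < k}"

lemma simple_graph_star_edges:
  assumes "F \<in> ({..<k} \<times> {..<N}) \<rightarrow>\<^sub>E {..<N}"
  shows "simple_graph {..<2 * N} (star_edges N k F)"
proof -
  have "F (j, i) < N" if "i < N" "j < k" for i j
    using assms that by (auto dest: PiE_mem)
  then show ?thesis
    unfolding simple_graph_def star_edges_def by (fastforce simp: card_2_iff)
qed

text \<open>Distinct arrows of one map have distinct left ends, so they can meet only in their right
  end, the centre \<open>Max e\<close>. An edge that comes from several maps is assigned to one of
  them.\<close>

lemma union_page_number_star_edges:
  assumes F: "F \<in> ({..<k} \<times> {..<N}) \<rightarrow>\<^sub>E {..<N}"
  shows "union_page_number {..<2 * N} (star_edges N k F) \<le> k"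
proof -
  define q where "q e = (SOME j. j < k \<and> (\<exists>i<N. e = {i, N + F (j, i)}))" for e
  have q: "q e < k \<and> (\<exists>i<N. e = {i, N + F (q e, i)})" if "e \<in> star_edges N k F" for e
    unfolding q_def by (rule someI_ex) (use that in \<open>auto simp: star_edges_def\<close>)
  have "union_page_number {..<2 * N} (star_edges N k F) \<le> card {..<k}"
  proof (rule union_page_number_le_star_forests[OF simple_graph_star_edges[OF F], where q = q and c = Max])
    show "q ` star_edges N k F \<subseteq> {..<k}" using q by auto
    show "Max e \<in> e" if "e \<in> star_edges N k F" for e
      using that by (intro Max_in) (auto simp: star_edges_def)
    fix e f assume e: "e \<in> star_edges N k F" and f: "f \<in> star_edges N k F"
      and qe: "q e = q f" and ne: "e \<inter> f \<noteq> {}"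
    define j where "j = q e"
    obtain i where i: "i < N" "e = {i, N + F (j, i)}"
      using q[OF e] unfolding j_def by blast
    obtain i' where i': "i' < N" "f = {i', N + F (j, i')}"
      using q[OF f] unfolding j_def qe by blast
    have "Max {x, N + y} = N + y" if "x < N" for x y using that by simp
    then have "Max e = N + F (j, i)" "Max f = N + F (j, i')" using i i' by blast+
    moreover have "F (j, i) = F (j, i')" using ne i i' by auto
    ultimately show "Max e = Max f" by simp
  qed simp
  then show ?thesis by simp
qed

section \<open>Tools for the union bound\<close>

text \<open>A form of the inequality of arithmetic and geometric means, obtained from
  \<open>x <= exp (x - 1)\<close> for \<open>x = d i / M\<close>.\<close>

lemma prod_le_power_of_sum_le:
  fixes d :: "'a \<Rightarrow> nat"
  assumes "finite I" "M > 0" "sum d I \<le> M * card I"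
  shows "prod d I \<le> M ^ card I"
proof -
  have "(\<Prod>i\<in>I. real (d i) / M) \<le> (\<Prod>i\<in>I. exp (real (d i) / M - 1))"
    by (intro prod_mono) (use exp_ge_add_one_self[of "real (d _) / M - 1"] in auto)
  also have "\<dots> = exp (\<Sum>i\<in>I. real (d i) / M - 1)"
    using assms(1) by (simp add: exp_sum)
  also have "(\<Sum>i\<in>I. real (d i) / M - 1) = real (sum d I) / M - card I"
    by (simp add: sum_subtractf sum_divide_distrib)
  also have "exp \<dots> \<le> 1"
    using assms(2,3) by (simp add: divide_le_eq mult.commute del: of_nat_sum flip: of_nat_mult)
  finally have "real (prod d I) \<le> real (M ^ card I)"
    using assms(2) by (simp add: prod_dividef)
  then show ?thesis by linarith
qed

text \<open>Ranks replace arbitrary positions, which leaves only finitely many spine orderings for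
  the union bound.\<close>

lemma order_preserving_positions:
  fixes \<sigma> :: "'a \<Rightarrow> nat"
  assumes "finite V" "inj_on \<sigma> V"
  obtains \<rho> where "inj_on \<rho> V" "\<rho> \<in> V \<rightarrow>\<^sub>E {..<card V}"
    "\<And>u v. u \<in> V \<Longrightarrow> v \<in> V \<Longrightarrow> \<rho> u < \<rho> v \<Longrightarrow> \<sigma> u < \<sigma> v"
proof
  let ?\<rho> = "restrict (\<lambda>v. card {w \<in> V. \<sigma> w < \<sigma> v}) V"
  have mono: "?\<rho> u < ?\<rho> v" if "u \<in> V" "v \<in> V" "\<sigma> u < \<sigma> v" for u v
  proof -
    have "{w \<in> V. \<sigma> w < \<sigma> u} \<subset> {w \<in> V. \<sigma> w < \<sigma> v}" using that by auto
    then show ?thesis using assms(1) that by (simp add: psubset_card_mono)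
  qed
  show "\<sigma> u < \<sigma> v" if "u \<in> V" "v \<in> V" "?\<rho> u < ?\<rho> v" for u v
  proof (rule ccontr)
    assume "\<not> \<sigma> u < \<sigma> v"
    then consider "\<sigma> v < \<sigma> u" | "\<sigma> u = \<sigma> v" by linarith
    then show False
    proof cases
      case 1
      then show False using mono[OF that(2,1)] that(3) by linarith
    next
      case 2
      then have "u = v" using inj_onD[OF assms(2)] that by blast
      then show False using that(3) by simp
    qed
  qed
  show "inj_on ?\<rho> V"
  proof (rule inj_onI)
    fix u v assume uv: "u \<in> V" "v \<in> V" "?\<rho> u = ?\<rho> v"
    then have "\<sigma> u = \<sigma> v" using mono[of u v] mono[of v u] by (metis less_irrefl nat_neq_iff)
    then show "u = v" using inj_onD[OF assms(2)] uv by blast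
  qed
  show "?\<rho> \<in> V \<rightarrow>\<^sub>E {..<card V}"
  proof
    fix v assume v: "v \<in> V"
    then have "{w \<in> V. \<sigma> w < \<sigma> v} \<subset> V" by auto
    then show "?\<rho> v \<in> {..<card V}" using v assms(1) by (simp add: psubset_card_mono)
  qed auto
qed

text \<open>Contraction to blocks of length \<open>b\<close> creates no crossings: strictly ordered
  blocks have strictly ordered vertices, so crossing contracted edges would lift to crossing edges
  of the page.\<close>

lemma book_embedding_block_quotient:
  assumes G: "simple_graph V E" and be: "book_embedding V E \<sigma> p" and t: "num_pages E p \<le> t"
    and sb: "s * b = card V" "b > 0"
  obtains \<rho> q where "\<rho> \<in> V \<rightarrow>\<^sub>E {..<card V}" "inj_on \<rho> V" "q \<in> {..<t} \<rightarrow>\<^sub>E noncrossing s"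
    "\<And>u v. {u, v} \<in> E \<Longrightarrow> \<rho> u div b < \<rho> v div b \<Longrightarrow> (\<rho> u div b, \<rho> v div b) \<in> \<Union>(q ` {..<t})"
proof -
  have fin: "finite V" and EV: "\<And>e. e \<in> E \<Longrightarrow> e \<subseteq> V"
    using G unfolding simple_graph_def by auto
  obtain \<rho> where \<rho>: "inj_on \<rho> V" "\<rho> \<in> V \<rightarrow>\<^sub>E {..<card V}"
    and mono: "\<And>u v. u \<in> V \<Longrightarrow> v \<in> V \<Longrightarrow> \<rho> u < \<rho> v \<Longrightarrow> \<sigma> u < \<sigma> v"
    using order_preserving_positions[OF fin] be
    unfolding book_embedding_def linear_embedding_def by metis
  have "finite (p ` E)" using simple_graph_finite_edges[OF G] by simp
  then obtain g where g: "inj_on g (p ` E)" "g ` p ` E \<subseteq> {..<t}"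
    using card_le_inj[of "p ` E" "{..<t}"] t unfolding num_pages_def by auto
  \<comment> \<open>Numbers below \<open>t\<close> that \<open>g\<close> gives to no page get the
    empty graph.\<close>
  define q where "q = restrict (\<lambda>c. {(\<rho> u div b, \<rho> v div b) | u v.
    {u, v} \<in> E \<and> g (p {u, v}) = c \<and> \<rho> u div b < \<rho> v div b}) {..<t}"
  have less: "\<sigma> u < \<sigma> v" if "u \<in> V" "v \<in> V" "\<rho> u div b < \<rho> v div b" for u v
    using mono that by (meson div_le_mono leD not_le_imp_less)
  have block: "\<rho> u div b < s" if "u \<in> V" for u
    using \<rho>(2) that sb by (auto simp: less_mult_imp_div_less dest!: PiE_mem)
  have "q c \<in> noncrossing s" if c: "c < t" for c
    unfolding noncrossing_def
  proof (intro CollectI conjI)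
    show "q c \<subseteq> {..<s} \<times> {..<s}"
      using EV block c by (auto simp: q_def)
    show "\<forall>(i, j)\<in>q c. i < j" using c by (auto simp: q_def)
    have "\<not> (i < i' \<and> i' < j \<and> j < j')" if ij: "(i, j) \<in> q c" and ij': "(i', j') \<in> q c" for i j i' j'
    proof
      assume *: "i < i' \<and> i' < j \<and> j < j'"
      obtain u v where uv: "i = \<rho> u div b" "j = \<rho> v div b" "{u, v} \<in> E" "g (p {u, v}) = c"
        using ij c by (auto simp: q_def)
      obtain x y where xy: "i' = \<rho> x div b" "j' = \<rho> y div b" "{x, y} \<in> E" "g (p {x, y}) = c"
        using ij' c by (auto simp: q_def)
      have "p {u, v} = p {x, y}" using g(1) uv xy by (metis imageI inj_onD)
      then have nc: "\<not> cross \<sigma> {u, v} {x, y}"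
        using be uv xy unfolding book_embedding_def by blast
      have "u \<in> V" "v \<in> V" "x \<in> V" "y \<in> V" using EV uv(3) xy(3) by auto
      then have "\<sigma> u < \<sigma> x" "\<sigma> x < \<sigma> v" "\<sigma> v < \<sigma> y" using less * uv xy by auto
      then show False using nc unfolding cross_def by blast
    qed
    then show "\<forall>(i, j)\<in>q c. \<forall>(i', j')\<in>q c. \<not> (i < i' \<and> i' < j \<and> j < j')" by blast
  qed
  then have "q \<in> {..<t} \<rightarrow>\<^sub>E noncrossing s" by (auto simp: q_def)
  moreover have "(\<rho> u div b, \<rho> v div b) \<in> \<Union>(q ` {..<t})"
    if "{u, v} \<in> E" "\<rho> u div b < \<rho> v div b" for u v
  proof -
    have "g (p {u, v}) < t" using g(2) that(1) by auto
    then show ?thesis using that by (auto simp: q_def)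
  qed
  ultimately show ?thesis using that \<rho> by blast
qed

text \<open>Quotient and remainder by \<open>b\<close> determine a position, so a pair of blocks
  accounts for at most \<open>b * b\<close> pairs of vertices.\<close>

lemma card_pairs_in_related_blocks:
  fixes \<rho> :: "nat \<Rightarrow> nat"
  assumes inj: "inj_on \<rho> {..<2 * N}" and "b > 0" and R: "finite R"
  shows "card {(i, y). i < N \<and> y < N \<and> (\<rho> i div b, \<rho> (N + y) div b) \<in> R} \<le> card R * b\<^sup>2"
    (is "card ?S \<le> _")
proof -
  define g where "g = (\<lambda>(i, y). ((\<rho> i div b, \<rho> (N + y) div b), (\<rho> i mod b, \<rho> (N + y) mod b)))"
  have "inj_on g ?S"
  proof (rule inj_onI, clarify)
    fix i y i' y' assume lt: "i < N" "y < N" "i' < N" "y' < N" and "g (i, y) = g (i', y')"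
    then have "\<rho> i div b = \<rho> i' div b" "\<rho> i mod b = \<rho> i' mod b"
      "\<rho> (N + y) div b = \<rho> (N + y') div b" "\<rho> (N + y) mod b = \<rho> (N + y') mod b"
      by (simp_all add: g_def)
    then have "\<rho> i = \<rho> i'" "\<rho> (N + y) = \<rho> (N + y')"
      by (metis div_mult_mod_eq)+
    then show "i = i' \<and> y = y'"
      using inj_onD[OF inj, of i i'] inj_onD[OF inj, of "N + y" "N + y'"] lt by simp
  qed
  moreover have "g ` ?S \<subseteq> R \<times> ({..<b} \<times> {..<b})"
    using \<open>b > 0\<close> by (auto simp: g_def)
  ultimately have "card ?S \<le> card (R \<times> ({..<b} \<times> {..<b}))"
    using R by (intro card_inj_on_le[of g]) auto
  then show ?thesis by (simp add: card_cartesian_product power2_eq_square)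
qed

text \<open>\<open>R\<close> has at most \<open>s + 2 * (2 * s * t) <= 5 * s * t\<close> elements:
  equal blocks, and the contracted edges in both directions. So the number of admissible values
  averages at most \<open>10 * t * b\<close> over \<open>i\<close>, and the product is bounded
  through this mean.\<close>

lemma card_choices_in_related_blocks:
  fixes \<rho> :: "nat \<Rightarrow> nat"
  assumes \<rho>: "inj_on \<rho> {..<2 * N}" and q: "q \<in> {..<t} \<rightarrow>\<^sub>E noncrossing s"
    and sb: "s * b = 2 * N" and pos: "b > 0" "t > 0"
  defines "U \<equiv> \<Union>(q ` {..<t})"
  defines "R \<equiv> Id_on {..<s} \<union> U \<union> U\<inverse>"
  shows "card (PiE ({..<k} \<times> {..<N}) (\<lambda>(j, i). {y. y < N \<and> (\<rho> i div b, \<rho> (N + y) div b) \<in> R}))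
    \<le> (10 * t * b) ^ (k * N)"
proof -
  define d where "d i = card {y. y < N \<and> (\<rho> i div b, \<rho> (N + y) div b) \<in> R}" for i
  have nc: "q c \<in> noncrossing s" if "c < t" for c using q that by (auto dest: PiE_mem)
  have finU: "finite U" unfolding U_def using nc noncrossingD(1) by auto
  have "card U \<le> (\<Sum>c<t. card (q c))" unfolding U_def by (intro card_UN_le) simp
  also have "\<dots> \<le> (\<Sum>c<t. 2 * s)" using nc card_noncrossing_edges by (intro sum_mono) auto
  finally have U: "card U \<le> 2 * s * t" by (simp add: mult.commute)
  have "card R \<le> card (Id_on {..<s}) + card U + card (U\<inverse>)"
    unfolding R_def by (meson add_le_mono card_Un_le le_refl le_trans)
  also have "card (Id_on {..<s}) \<le> s"
    using card_image_le[of "{..<s}" "\<lambda>x. (x, x)"] by (simp add: Id_on_def UNION_singleton_eq_range)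
  also have "s + card U + card (U\<inverse>) \<le> s * t + 2 * s * t + 2 * s * t"
    using U pos by (intro add_mono) auto
  finally have cardR: "card R \<le> 5 * s * t" by simp
  have finR: "finite R" unfolding R_def using finU by (simp add: Id_on_def)
  have "(\<Sum>i<N. d i) = card (SIGMA i:{..<N}. {y. y < N \<and> (\<rho> i div b, \<rho> (N + y) div b) \<in> R})"
    unfolding d_def by (subst card_SigmaI) auto
  also have "(SIGMA i:{..<N}. {y. y < N \<and> (\<rho> i div b, \<rho> (N + y) div b) \<in> R})
    = {(i, y). i < N \<and> y < N \<and> (\<rho> i div b, \<rho> (N + y) div b) \<in> R}" by auto
  also have "card \<dots> \<le> card R * b\<^sup>2"
    by (rule card_pairs_in_related_blocks[OF \<rho> pos(1) finR])
  also have "\<dots> \<le> 5 * s * t * b\<^sup>2" using cardR by (rule mult_le_mono1)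
  also have "\<dots> = 5 * t * b * (s * b)" by (simp add: power2_eq_square)
  also have "\<dots> = 10 * t * b * N" using sb by simp
  finally have sumd: "(\<Sum>i<N. d i) \<le> 10 * t * b * N" .
  have "(\<Sum>x\<in>{..<k} \<times> {..<N}. d (snd x)) = k * (\<Sum>i<N. d i)"
    using sum.cartesian_product[of "\<lambda>_. d" "{..<N}" "{..<k}"] by (simp add: case_prod_unfold)
  also have "\<dots> \<le> 10 * t * b * card ({..<k} \<times> {..<N})"
    using mult_le_mono2[OF sumd, of k] by (simp add: card_cartesian_product algebra_simps)
  finally have "(\<Prod>x\<in>{..<k} \<times> {..<N}. d (snd x)) \<le> (10 * t * b) ^ card ({..<k} \<times> {..<N})"
    using pos by (intro prod_le_power_of_sum_le) auto
  then show ?thesis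
    by (simp add: card_PiE card_cartesian_product d_def case_prod_unfold)
qed

text \<open>The factors on the left of \<open>count\<close> bound the orderings, the contracted
  pages, and the functions compatible with one choice of both. If \<open>t\<close> pages always
  sufficed, these functions would cover all \<open>N ^ (k * N)\<close> possible ones.\<close>

lemma exists_star_edges_large_page_number:
  assumes sb: "s * b = 2 * N" and pos: "b > 0" "t > 0"
    and count: "(2 * N) ^ (2 * N) * 64 ^ (s * t) * (10 * t * b) ^ (k * N) < N ^ (k * N)"
  shows "\<exists>F \<in> ({..<k} \<times> {..<N}) \<rightarrow>\<^sub>E {..<N}. t < page_number {..<2 * N} (star_edges N k F)"
proof (rule ccontr)
  assume "\<not> ?thesis"
  then have small: "page_number {..<2 * N} (star_edges N k F) \<le> t"
    if "F \<in> ({..<k} \<times> {..<N}) \<rightarrow>\<^sub>E {..<N}" for F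
    using that by (meson not_le_imp_less)
  define P where "P = ({..<2 * N} \<rightarrow>\<^sub>E {..<2 * N}) \<times> ({..<t} \<rightarrow>\<^sub>E noncrossing s)"
  define J where "J = {(\<rho>, q) \<in> P. inj_on \<rho> {..<2 * N}}"
  define S where "S = (\<lambda>(\<rho>, q). PiE ({..<k} \<times> {..<N}) (\<lambda>(j, i). {y. y < N \<and>
    (\<rho> i div b, \<rho> (N + y) div b) \<in> Id_on {..<s} \<union> \<Union>(q ` {..<t}) \<union> (\<Union>(q ` {..<t}))\<inverse>}))"
  have finP: "finite P" unfolding P_def by (simp add: finite_PiE finite_noncrossing)
  then have finJ: "finite J" unfolding J_def by (rule rev_finite_subset) auto
  have "card J \<le> card P" unfolding J_def using finP by (intro card_mono) auto
  also have "\<dots> = (2 * N) ^ (2 * N) * card (noncrossing s) ^ t"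
    unfolding P_def by (simp add: card_cartesian_product card_PiE)
  also have "\<dots> \<le> (2 * N) ^ (2 * N) * 64 ^ (s * t)"
    using card_noncrossing by (simp add: power_mono power_mult)
  finally have cardJ: "card J \<le> (2 * N) ^ (2 * N) * 64 ^ (s * t)" .
  have "({..<k} \<times> {..<N}) \<rightarrow>\<^sub>E {..<N} \<subseteq> (\<Union>x\<in>J. S x)"
  proof
    fix F assume F: "F \<in> ({..<k} \<times> {..<N}) \<rightarrow>\<^sub>E {..<N}"
    note G = simple_graph_star_edges[OF F]
    obtain \<sigma> p where "book_embedding {..<2 * N} (star_edges N k F) \<sigma> p"
      "num_pages (star_edges N k F) p \<le> t"
      using page_number_attained[OF G] small[OF F] by metis
    then obtain \<rho> q where \<rho>: "\<rho> \<in> {..<2 * N} \<rightarrow>\<^sub>E {..<2 * N}" "inj_on \<rho> {..<2 * N}"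
      and q: "q \<in> {..<t} \<rightarrow>\<^sub>E noncrossing s"
      and edge: "\<And>u v. {u, v} \<in> star_edges N k F \<Longrightarrow> \<rho> u div b < \<rho> v div b \<Longrightarrow>
        (\<rho> u div b, \<rho> v div b) \<in> \<Union>(q ` {..<t})"
      using book_embedding_block_quotient[OF G] sb pos(1) by (metis card_lessThan)
    have "(\<rho>, q) \<in> J" using \<rho> q by (simp add: J_def P_def)
    moreover have "F \<in> S (\<rho>, q)"
      unfolding S_def case_prod_conv
    proof (rule PiE_I)
      fix x assume x: "x \<in> {..<k} \<times> {..<N}"
      then obtain j i where ji: "x = (j, i)" "j < k" "i < N" by auto
      have FN: "F (j, i) < N" using F x ji by (auto dest: PiE_mem)
      \<comment> \<open>An arrow may run either way along the spine: increasing blocks fall into the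
        union of the contracted pages, decreasing ones into its converse, equal ones into the
        diagonal.\<close>
      have e: "{i, N + F (j, i)} \<in> star_edges N k F" "{N + F (j, i), i} \<in> star_edges N k F"
        using ji by (auto simp: star_edges_def)
      have "\<rho> i < s * b" using \<rho>(1) ji sb by (auto dest!: PiE_mem[of _ _ _ i])
      then have "\<rho> i div b < s" by (rule less_mult_imp_div_less)
      then have "(\<rho> i div b, \<rho> (N + F (j, i)) div b) \<in>
          Id_on {..<s} \<union> \<Union>(q ` {..<t}) \<union> (\<Union>(q ` {..<t}))\<inverse>"
        using edge[OF e(1)] edge[OF e(2)]
        by (cases "\<rho> i div b" "\<rho> (N + F (j, i)) div b" rule: linorder_cases) auto
      then show "F x \<in> (case x of (j, i) \<Rightarrow> {y. y < N \<and>
          (\<rho> i div b, \<rho> (N + y) div b) \<in> Id_on {..<s} \<union> \<Union>(q ` {..<t}) \<union> (\<Union>(q ` {..<t}))\<inverse>})"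
        using FN ji by simp
    qed (use F in auto)
    ultimately show "F \<in> (\<Union>x\<in>J. S x)" by blast
  qed
  moreover have "finite (S x)" for x
    unfolding S_def by (cases x) (auto intro!: finite_PiE)
  ultimately have "card (({..<k} \<times> {..<N}) \<rightarrow>\<^sub>E {..<N}) \<le> card (\<Union>x\<in>J. S x)"
    using finJ by (intro card_mono) auto
  also have "\<dots> \<le> (\<Sum>x\<in>J. card (S x))" using finJ by (rule card_UN_le)
  also have "\<dots> \<le> (\<Sum>x\<in>J. (10 * t * b) ^ (k * N))"
  proof (rule sum_mono)
    fix x assume "x \<in> J"
    then obtain \<rho> q where "x = (\<rho>, q)" "inj_on \<rho> {..<2 * N}" "q \<in> {..<t} \<rightarrow>\<^sub>E noncrossing s"
      by (auto simp: J_def P_def)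
    then show "card (S x) \<le> (10 * t * b) ^ (k * N)"
      unfolding S_def using card_choices_in_related_blocks[OF _ _ sb pos] by simp
  qed
  also have "\<dots> \<le> (2 * N) ^ (2 * N) * 64 ^ (s * t) * (10 * t * b) ^ (k * N)"
    using cardJ by (simp add: mult_le_mono1)
  also have "\<dots> < N ^ (k * N)" by (rule count)
  finally show False by (simp add: card_PiE card_cartesian_product)
qed

section \<open>Choice of the parameters\<close>

text \<open>Powers of \<open>X\<close> avoid rounding: for \<open>n = 2 * N = X ^ (2 * k)\<close>,
  \<open>n powr (2 / k)\<close> is \<open>X ^ 4\<close> and \<open>n powr (1 / 2 - 1 / k)\<close> is
  \<open>X ^ (k - 2)\<close>. The factor \<open>Y\<close> of \<open>X\<close> makes \<open>n\<close>
  arbitrarily large.\<close>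

lemma exists_graph_large_page_number:
  assumes k: "k \<ge> 3" and Y: "Y > 0"
  obtains n and V :: "nat set" and E where "n \<ge> Y" "simple_graph V E" "card V = n"
    "union_page_number V E \<le> k"
    "1 / 128 * sqrt (real k) * real n powr (1 / 2 - 1 / real k) \<le> real (page_number V E)"
proof -
  \<comment> \<open>An integer substitute for \<open>sqrt k\<close>: \<open>r ^ 2 <= k\<close>
    bounds \<open>s * t\<close>, and \<open>sqrt k <= 2 * r\<close> costs a factor 2 in the final
    constant.\<close>
  define r where "r = nat \<lfloor>sqrt (real k)\<rfloor>"
  have sq: "1 \<le> sqrt (real k)" using k by simp
  have r1: "1 \<le> r" unfolding r_def using sq by linarith
  have "real r \<le> sqrt (real k)" unfolding r_def using sq by linarith
  then have "real r ^ 2 \<le> real k"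
    by (metis of_nat_0_le_iff power_mono real_sqrt_pow2)
  then have rk: "r ^ 2 \<le> k" by (metis of_nat_le_iff of_nat_power)
  have "sqrt (real k) < real r + 1" unfolding r_def using sq by linarith
  then have kr: "sqrt (real k) \<le> 2 * real r" using r1 by linarith
  define X where "X = 64 * 2048 * r * Y"
  define u where "u = X ^ (k - 3)"
  \<comment> \<open>Thus \<open>t\<close> is \<open>r / 64 * X ^ (k - 2)\<close>, and
    \<open>b\<close> satisfies \<open>r ^ 2 * b = 2 * t\<close>, which yields
    \<open>s * t = r ^ 2 * N\<close>.\<close>
  define t where "t = 2048 * r\<^sup>2 * Y * u"
  define b where "b = 4096 * Y * u"
  define s where "s = 2048 * t * X ^ 4"
  define N where "N = 1024 * t * X ^ 4 * b"
  have X0: "X > 0" using r1 Y by (simp add: X_def)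
  have pos: "b > 0" "t > 0" using X0 r1 Y by (simp_all add: b_def t_def u_def)
  have sb: "s * b = 2 * N" by (simp add: s_def N_def)
  have n: "2 * N = X ^ (2 * k)"
  proof -
    have "X\<^sup>2 = 4096 * 4194304 * r\<^sup>2 * Y\<^sup>2" by (simp add: X_def power_mult_distrib)
    then have "2 * N = X ^ 4 * X\<^sup>2 * u\<^sup>2"
      by (simp add: N_def t_def b_def power2_eq_square)
    also have "\<dots> = X ^ (4 + 2 + (k - 3) * 2)" by (simp only: u_def power_add power_mult)
    also have "4 + 2 + (k - 3) * 2 = 2 * k" using k by simp
    finally show ?thesis .
  qed
  have st: "s * t \<le> k * N"
  proof -
    have "s * t = r\<^sup>2 * N"
      unfolding s_def N_def t_def b_def by (simp add: power2_eq_square)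
    then show ?thesis using rk by simp
  qed
  have N0: "k * N > 0" using k pos X0 by (simp add: N_def)
  \<comment> \<open>Every factor is brought to the exponent \<open>k * N\<close>; the bases then
    compare as \<open>640 * X ^ 4 * t * b\<close> against
    \<open>N = 1024 * X ^ 4 * t * b\<close>.\<close>
  have "(2 * N) ^ (2 * N) * 64 ^ (s * t) * (10 * t * b) ^ (k * N)
      \<le> (X ^ (2 * k)) ^ (2 * N) * 64 ^ (k * N) * (10 * t * b) ^ (k * N)"
    unfolding n by (intro mult_le_mono le_refl power_increasing st) auto
  also have "(X ^ (2 * k)) ^ (2 * N) = (X ^ 4) ^ (k * N)"
    by (simp add: ac_simps flip: power_mult)
  also have "(X ^ 4) ^ (k * N) * 64 ^ (k * N) * (10 * t * b) ^ (k * N)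
      = (X ^ 4 * 64 * (10 * t * b)) ^ (k * N)" by (simp only: power_mult_distrib)
  also have "\<dots> < N ^ (k * N)"
    using pos X0 N0 by (intro power_strict_mono) (simp_all add: N_def)
  finally obtain F where F: "F \<in> ({..<k} \<times> {..<N}) \<rightarrow>\<^sub>E {..<N}"
    and pn: "t < page_number {..<2 * N} (star_edges N k F)"
    using exists_star_edges_large_page_number[OF sb pos] by blast
  have "real (X ^ (2 * k)) powr (1 / 2 - 1 / real k) = real X ^ (k - 2)"
  proof -
    have "real (X ^ (2 * k)) = real X powr real (2 * k)"
      using X0 by (simp add: powr_realpow del: of_nat_mult)
    then have "real (X ^ (2 * k)) powr (1 / 2 - 1 / real k)
        = real X powr (real (2 * k) * (1 / 2 - 1 / real k))"
      by (simp add: powr_powr)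
    also have "real (2 * k) * (1 / 2 - 1 / real k) = real (k - 2)"
      using k by (simp add: field_simps of_nat_diff)
    finally show ?thesis using X0 by (simp add: powr_realpow)
  qed
  then have "1 / 128 * sqrt (real k) * real (2 * N) powr (1 / 2 - 1 / real k)
      \<le> 1 / 128 * (2 * real r) * real X ^ (k - 2)"
    unfolding n using kr by (simp only:) (intro mult_right_mono mult_left_mono; simp)
  also have "\<dots> = real r / 64 * (real X * real u)"
  proof -
    have "k - 2 = Suc (k - 3)" using k by simp
    then show ?thesis by (simp add: u_def)
  qed
  also have "\<dots> = real t" by (simp add: t_def X_def power2_eq_square)
  also have "\<dots> \<le> real (page_number {..<2 * N} (star_edges N k F))" using pn by simp
  finally have "1 / 128 * sqrt (real k) * real (2 * N) powr (1 / 2 - 1 / real k)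
      \<le> real (page_number {..<2 * N} (star_edges N k F))" .
  moreover have "Y \<le> 2 * N"
  proof -
    have "Y \<le> X" using r1 by (simp add: X_def)
    also have "X \<le> X ^ (2 * k)" using X0 k by (simp add: self_le_power)
    finally show ?thesis by (simp add: n)
  qed
  ultimately show ?thesis
    using that simple_graph_star_edges[OF F] union_page_number_star_edges[OF F] by simp
qed

theorem theorem1:
  shows "(\<exists>c::real. c > 0 \<and>
           (\<forall>k::nat. k \<ge> 3 \<longrightarrow>
              infinite {n::nat. \<exists>(V::nat set) E. simple_graph V E \<and> card V = n \<and>
                 local_page_number V E \<le> union_page_number V E \<and>
                 union_page_number V E \<le> k + 2 \<and>
                 real (page_number V E) \<ge> c * sqrt (real k) * real n powr (1/2 - 1 / real k)}))
       \<and> (\<forall>(V::'a set) E. simple_graph V E \<longrightarrow>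
              union_page_number V E \<le> 4 * local_page_number V E + 2)"
proof (intro conjI allI impI exI[of _ "1/128 :: real"])
  \<comment> \<open>The witness \<open>1/128\<close> is fixed before \<open>k\<close>, so the
    constant hidden in the asymptotic bound is uniform in \<open>k\<close>.\<close>
  fix k :: nat assume k: "k \<ge> 3"
  show "infinite {n::nat. \<exists>(V::nat set) E. simple_graph V E \<and> card V = n \<and>
                 local_page_number V E \<le> union_page_number V E \<and>
                 union_page_number V E \<le> k + 2 \<and>
                 real (page_number V E) \<ge> 1/128 * sqrt (real k) * real n powr (1/2 - 1 / real k)}"
    unfolding infinite_nat_iff_unbounded_le
  proof
    fix m :: nat
    obtain n and V :: "nat set" and E where "n \<ge> Suc m" "simple_graph V E" "card V = n"
      "union_page_number V E \<le> k"
      "1 / 128 * sqrt (real k) * real n powr (1 / 2 - 1 / real k) \<le> real (page_number V E)"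
      using exists_graph_large_page_number[OF k zero_less_Suc] by blast
    then show "\<exists>n\<ge>m. n \<in> {n. \<exists>(V::nat set) E. simple_graph V E \<and> card V = n \<and>
                 local_page_number V E \<le> union_page_number V E \<and>
                 union_page_number V E \<le> k + 2 \<and>
                 real (page_number V E) \<ge> 1/128 * sqrt (real k) * real n powr (1/2 - 1 / real k)}"
      using local_page_number_le_union_page_number
      by (intro exI[of _ n]) (auto intro!: exI[of _ V] exI[of _ E])
  qed
next
  fix V :: "'a set" and E assume "simple_graph V E"
  then show "union_page_number V E \<le> 4 * local_page_number V E + 2"
    using union_page_number_le_4_local_page_number trans_le_add1 by blast
qed simp

end
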